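(* Let $(A,d_A)$ be a differential algebra of weight $\lambda$ and let $(V,d_V)$ be a bimodule over $(A,d_A)$. There exists an exact sequence of cochain complexes $$0\to C^{*-1}_{\mathsf{DO}_\lambda}(d_A,d_V)\xrightarrow{\ \iota\ }C^*_{\mathsf{DA}_\lambda}(A,V)\xrightarrow{\ \pi\ }C^*_{\mathsf{Alg}}(A,V)\to0,$$ where $\iota$ is the inclusion $g\mapsto(0,g)$ and $\pi$ is the projection $(f,g)\mapsto f$ (in degree $0$, $\pi$ is the identity of $V$), and where the three complexes have differentials $\partial_\lambda$, $\partial_{\mathsf{DA}_\lambda}$ and $\partial$ respectively.
   Context: Throughout, $\mathbf{k}$ is a field of characteristic zero; all vector spaces, algebras, linear maps and tensor products are over $\mathbf{k}$. Fix $\lambda\in\mathbf{k}$. A differential algebra of weight $\lambda$ is an associative algebra $A$ with a linear operator $d_A:A\to A$ such that $d_A(xy)=d_A(x)y+xd_A(y)+\lambda d_A(x)d_A(y)$ for all $x,y\in A$; if $A$ is unital one further requires $d_A(1_A)=0$. A bimodule over $(A,d_A)$ is a bimodule $V$ over the associative algebra $A$ (left action $xv$, right action $vx$) with $d_V\in\mathrm{End}_{\mathbf{k}}(V)$ such that $d_V(xv)=d_A(x)v+xd_V(v)+\lambda d_A(x)d_V(v)$ and $d_V(vx)=vd_A(x)+d_V(v)x+\lambda d_V(v)d_A(x)$ for all $x\in A,v\in V$. The formulas $x\vdash_\lambda v=(x+\lambda d_A(x))v$, $v\dashv_\lambda x=v(x+\lambda d_A(x))$ define another bimodule structure on $(V,d_V)$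 over $(A,d_A)$. Set $C^n_{\mathsf{Alg}}(A,V)=C^n_{\mathsf{DO}_\lambda}(d_A,d_V)=\mathrm{Hom}(A^{\otimes n},V)$ for $n\ge0$ (equal to $V$ for $n=0$), and $0$ for $n<0$. The operator $\partial:C^n_{\mathsf{Alg}}(A,V)\to C^{n+1}_{\mathsf{Alg}}(A,V)$ is the Hochschild coboundary $$\partial f(x_1,\dots,x_{n+1})=x_1f(x_2,\dots,x_{n+1})+\sum_{i=1}^n(-1)^if(x_1,\dots,x_ix_{i+1},\dots,x_{n+1})+(-1)^{n+1}f(x_1,\dots,x_n)x_{n+1},$$ and $\partial_\lambda:C^n_{\mathsf{DO}_\lambda}(d_A,d_V)\to C^{n+1}_{\mathsf{DO}_\lambda}(d_A,d_V)$ is $$\partial_\lambda f(x_1,\dots,x_{n+1})=x_1\vdash_\lambda f(x_2,\dots,x_{n+1})+\sum_{i=1}^n(-1)^if(x_1,\dots,x_ix_{i+1},\dots,x_{n+1})+(-1)^{n+1}f(x_1,\dots,x_n)\dashv_\lambda x_{n+1}.$$ The linear map $\delta:C^n_{\mathsf{Alg}}(A,V)\to C^n_{\mathsf{DO}_\lambda}(d_A,d_V)$ is defined for $n\ge1$ by $$\delta f(x_1,\dots,x_n)=\sum_{k=1}^n\lambda^{k-1}\sum_{1\le i_1<\cdots<i_k\le n}f(x_1,\dots,d_A(x_{i_1}),\dots,d_A(x_{i_k}),\dots,x_n)-d_V(f(x_1,\dots,x_n)),$$ and for $n=0$ by $\delta v=-d_V(v)$. The complex $(C^*_{\mathsf{DA}_\lambda}(A,V),\partial_{\mathsf{DA}_\lambda})$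 is given by $C^0_{\mathsf{DA}_\lambda}(A,V)=V$ and $C^n_{\mathsf{DA}_\lambda}(A,V)=C^n_{\mathsf{Alg}}(A,V)\oplus C^{n-1}_{\mathsf{DO}_\lambda}(d_A,d_V)$ for $n\ge1$, with $\partial_{\mathsf{DA}_\lambda}(f,g)=(\partial f,\ \partial_\lambda g+(-1)^n\delta f)$ for $f\in C^n_{\mathsf{Alg}}(A,V)$, $g\in C^{n-1}_{\mathsf{DO}_\lambda}(d_A,d_V)$, $n\ge1$, and $\partial_{\mathsf{DA}_\lambda}v=(\partial v,\delta v)$ for $v\in V$. *)

theory Defs
  imports "HOL-Analysis.Product_Vector" "HOL-Library.Function_Algebras"
begin

section \<open>Differential algebras of weight \<open>\<lambda>\<close> and their bimodules\<close>

text \<open>The class \<^class>\<open>ring\<close> does not require a unit.\<close>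

locale assoc_algebra = vector_space sA
  for sA :: "'k::field \<Rightarrow> 'a::ring \<Rightarrow> 'a" +
  assumes mult_scale_left: "sA c x * y = sA c (x * y)"
    and mult_scale_right: "x * sA c y = sA c (x * y)"

locale differential_algebra = assoc_algebra sA
  for sA :: "'k::field \<Rightarrow> 'a::ring \<Rightarrow> 'a" +
  fixes lam :: 'k and dA :: "'a \<Rightarrow> 'a"
  assumes linear_dA: "Vector_Spaces.linear sA sA dA"
    and dA_mult: "dA (x * y) = dA x * y + x * dA y + sA lam (dA x * dA y)"
    and dA_unit: "(\<forall>x. e * x = x \<and> x * e = x) \<Longrightarrow> dA e = 0"

locale algebra_bimodule = A: assoc_algebra sA + V: vector_space sV
  for sA :: "'k::field \<Rightarrow> 'a::ring \<Rightarrow> 'a"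
    and sV :: "'k \<Rightarrow> 'v::ab_group_add \<Rightarrow> 'v" +
  fixes l :: "'a \<Rightarrow> 'v \<Rightarrow> 'v" and r :: "'v \<Rightarrow> 'a \<Rightarrow> 'v"
  assumes linear_l_left: "Vector_Spaces.linear sA sV (\<lambda>x. l x v)"
    and linear_l_right: "Vector_Spaces.linear sV sV (\<lambda>v. l x v)"
    and linear_r_left: "Vector_Spaces.linear sV sV (\<lambda>v. r v x)"
    and linear_r_right: "Vector_Spaces.linear sA sV (\<lambda>x. r v x)"
    and l_mult: "l (x * y) v = l x (l y v)"
    and r_mult: "r v (x * y) = r (r v x) y"
    and l_r_assoc: "r (l x v) y = l x (r v y)"

locale differential_bimodule = differential_algebra sA lam dA + algebra_bimodule sA sV l r
  for sA :: "'k::field \<Rightarrow> 'a::ring \<Rightarrow> 'a" and lam :: 'k and dA :: "'a \<Rightarrow> 'a"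
    and sV :: "'k \<Rightarrow> 'v::ab_group_add \<Rightarrow> 'v"
    and l :: "'a \<Rightarrow> 'v \<Rightarrow> 'v" and r :: "'v \<Rightarrow> 'a \<Rightarrow> 'v" +
  fixes dV :: "'v \<Rightarrow> 'v"
  assumes linear_dV: "Vector_Spaces.linear sV sV dV"
    and dV_l: "dV (l x v) = l (dA x) v + l x (dV v) + sV lam (l (dA x) (dV v))"
    and dV_r: "dV (r v x) = r v (dA x) + r (dV v) x + sV lam (r (dV v) (dA x))"

text \<open>The actions \<open>\<turnstile>\<^sub>\<lambda>\<close> and \<open>\<stileturn>\<^sub>\<lambda>\<close>.\<close>

definition left_lam ::
    "('k \<Rightarrow> 'a \<Rightarrow> 'a) \<Rightarrow> 'k \<Rightarrow> ('a \<Rightarrow> 'a) \<Rightarrow> ('a \<Rightarrow> 'v \<Rightarrow> 'v) \<Rightarrow> 'a::ring \<Rightarrow> 'v \<Rightarrow> 'v"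
  where "left_lam sA lam dA l x v = l (x + sA lam (dA x)) v"

definition right_lam ::
    "('k \<Rightarrow> 'a \<Rightarrow> 'a) \<Rightarrow> 'k \<Rightarrow> ('a \<Rightarrow> 'a) \<Rightarrow> ('v \<Rightarrow> 'a \<Rightarrow> 'v) \<Rightarrow> 'v \<Rightarrow> 'a::ring \<Rightarrow> 'v"
  where "right_lam sA lam dA r v x = r v (x + sA lam (dA x))"

section \<open>Cochain spaces\<close>

text \<open>
  An element of \<open>Hom(A\<^sup>\<otimes>\<^sup>n, V)\<close> is an \<open>n\<close>-linear map, encoded as a function on lists that
  vanishes on every list of length other than \<open>n\<close>; the vector space operations are the
  pointwise ones. For \<open>n = 0\<close> such a function is determined by its value at \<open>[]\<close>, an arbitrary
  element of \<open>V\<close> (see \<open>multilinear_maps_0\<close> below).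
\<close>

definition multilinear_maps ::
    "('k::field \<Rightarrow> 'a::ab_group_add \<Rightarrow> 'a) \<Rightarrow> ('k \<Rightarrow> 'v::ab_group_add \<Rightarrow> 'v) \<Rightarrow> nat
      \<Rightarrow> ('a list \<Rightarrow> 'v) set"
  where "multilinear_maps sA sV n =
    {f. (\<forall>xs. length xs \<noteq> n \<longrightarrow> f xs = 0) \<and>
        (\<forall>xs i. length xs = n \<longrightarrow> i < n \<longrightarrow> Vector_Spaces.linear sA sV (\<lambda>x. f (xs[i := x])))}"

definition scale_fun :: "('k \<Rightarrow> 'v \<Rightarrow> 'v) \<Rightarrow> 'k \<Rightarrow> ('a list \<Rightarrow> 'v) \<Rightarrow> 'a list \<Rightarrow> 'v"
  where "scale_fun sV c f = (\<lambda>xs. sV c (f xs))"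

definition C_Alg ::
    "('k::field \<Rightarrow> 'a::ab_group_add \<Rightarrow> 'a) \<Rightarrow> ('k \<Rightarrow> 'v::ab_group_add \<Rightarrow> 'v) \<Rightarrow> int
      \<Rightarrow> ('a list \<Rightarrow> 'v) set"
  where "C_Alg sA sV n = (if n < 0 then {0} else multilinear_maps sA sV (nat n))"

definition C_DO ::
    "('k::field \<Rightarrow> 'a::ab_group_add \<Rightarrow> 'a) \<Rightarrow> ('k \<Rightarrow> 'v::ab_group_add \<Rightarrow> 'v) \<Rightarrow> int
      \<Rightarrow> ('a list \<Rightarrow> 'v) set"
  where "C_DO sA sV n = C_Alg sA sV n"

text \<open>Since \<open>C_DO\<close> is zero in degree \<open>-1\<close>, degree \<open>0\<close> below is \<open>V \<oplus> 0\<close>, that is \<open>V\<close>.\<close>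

definition C_DA ::
    "('k::field \<Rightarrow> 'a::ab_group_add \<Rightarrow> 'a) \<Rightarrow> ('k \<Rightarrow> 'v::ab_group_add \<Rightarrow> 'v) \<Rightarrow> int
      \<Rightarrow> (('a list \<Rightarrow> 'v) \<times> ('a list \<Rightarrow> 'v)) set"
  where "C_DA sA sV n = C_Alg sA sV n \<times> C_DO sA sV (n - 1)"

section \<open>Differentials\<close>

text \<open>
  The Hochschild coboundary for actions \<open>l\<close> and \<open>r\<close>. The degree \<open>n\<close> of the argument is read off
  from the list \<open>[x\<^sub>1, \<dots>, x\<^sub>n\<^sub>+\<^sub>1]\<close>, whose entry \<open>x\<^sub>i\<close> is \<open>xs ! (i - 1)\<close>.
\<close>

definition hochschild ::
    "('k::field \<Rightarrow> 'v \<Rightarrow> 'v) \<Rightarrow> ('a::ring \<Rightarrow> 'v \<Rightarrow> 'v) \<Rightarrow> ('v \<Rightarrow> 'a \<Rightarrow> 'v)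
      \<Rightarrow> ('a list \<Rightarrow> 'v::ab_group_add) \<Rightarrow> 'a list \<Rightarrow> 'v"
  where "hochschild sV l r f xs =
    (if xs = [] then 0
     else let n = length xs - 1 in
       l (hd xs) (f (tl xs))
       + (\<Sum>i=1..n. sV ((-1) ^ i) (f (take (i - 1) xs @ [xs ! (i - 1) * xs ! i] @ drop (i + 1) xs)))
       + sV ((-1) ^ (n + 1)) (r (f (butlast xs)) (last xs)))"

definition hochschild_lam ::
    "('k::field \<Rightarrow> 'a \<Rightarrow> 'a) \<Rightarrow> 'k \<Rightarrow> ('a \<Rightarrow> 'a)
      \<Rightarrow> ('k \<Rightarrow> 'v \<Rightarrow> 'v) \<Rightarrow> ('a::ring \<Rightarrow> 'v \<Rightarrow> 'v) \<Rightarrow> ('v \<Rightarrow> 'a \<Rightarrow> 'v)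
      \<Rightarrow> ('a list \<Rightarrow> 'v::ab_group_add) \<Rightarrow> 'a list \<Rightarrow> 'v"
  where "hochschild_lam sA lam dA sV l r =
    hochschild sV (left_lam sA lam dA l) (right_lam sA lam dA r)"

text \<open>
  The index set \<open>I\<close> is the set \<open>{i\<^sub>1, \<dots>, i\<^sub>k}\<close> shifted to start at \<open>0\<close>. For \<open>xs = []\<close> the sum is
  empty, which gives \<open>- dV v\<close> in degree \<open>0\<close>.
\<close>

definition delta ::
    "'k::field \<Rightarrow> ('a \<Rightarrow> 'a) \<Rightarrow> ('k \<Rightarrow> 'v \<Rightarrow> 'v) \<Rightarrow> ('v \<Rightarrow> 'v)
      \<Rightarrow> ('a list \<Rightarrow> 'v::ab_group_add) \<Rightarrow> 'a list \<Rightarrow> 'v"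
  where "delta lam dA sV dV f xs =
    (let n = length xs in
      (\<Sum>k=1..n. sV (lam ^ (k - 1))
        (\<Sum>I | I \<subseteq> {0..<n} \<and> card I = k.
          f (map (\<lambda>i. if i \<in> I then dA (xs ! i) else xs ! i) [0..<n])))
      - dV (f xs))"

definition d_DA ::
    "('k::field \<Rightarrow> 'a \<Rightarrow> 'a) \<Rightarrow> 'k \<Rightarrow> ('a \<Rightarrow> 'a)
      \<Rightarrow> ('k \<Rightarrow> 'v \<Rightarrow> 'v) \<Rightarrow> ('a::ring \<Rightarrow> 'v \<Rightarrow> 'v) \<Rightarrow> ('v \<Rightarrow> 'a \<Rightarrow> 'v) \<Rightarrow> ('v \<Rightarrow> 'v)
      \<Rightarrow> int \<Rightarrow> ('a list \<Rightarrow> 'v::ab_group_add) \<times> ('a list \<Rightarrow> 'v)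
      \<Rightarrow> ('a list \<Rightarrow> 'v) \<times> ('a list \<Rightarrow> 'v)"
  where "d_DA sA lam dA sV l r dV n = (\<lambda>(f, g).
    if n < 0 then 0
    else if n = 0 then (hochschild sV l r f, delta lam dA sV dV f)
    else (hochschild sV l r f,
          hochschild_lam sA lam dA sV l r g
          + scale_fun sV ((-1) ^ nat n) (delta lam dA sV dV f)))"

section \<open>Short exact sequences of cochain complexes\<close>

text \<open>Graded spaces are families of subspaces of one ambient space, indexed by the integers.\<close>

definition linear_map_on ::
    "('k::field \<Rightarrow> 'x::ab_group_add \<Rightarrow> 'x) \<Rightarrow> ('k \<Rightarrow> 'y::ab_group_add \<Rightarrow> 'y)
      \<Rightarrow> 'x set \<Rightarrow> 'y set \<Rightarrow> ('x \<Rightarrow> 'y) \<Rightarrow> bool"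
  where "linear_map_on s t S T f \<longleftrightarrow>
    f ` S \<subseteq> T \<and>
    (\<forall>x\<in>S. \<forall>y\<in>S. f (x + y) = f x + f y) \<and>
    (\<forall>c. \<forall>x\<in>S. f (s c x) = t c (f x))"

definition cochain_complex ::
    "('k::field \<Rightarrow> 'x::ab_group_add \<Rightarrow> 'x) \<Rightarrow> (int \<Rightarrow> 'x set) \<Rightarrow> (int \<Rightarrow> 'x \<Rightarrow> 'x) \<Rightarrow> bool"
  where "cochain_complex s C d \<longleftrightarrow>
    vector_space s \<and>
    (\<forall>n. module.subspace s (C n)) \<and>
    (\<forall>n. linear_map_on s s (C n) (C (n + 1)) (d n)) \<and>
    (\<forall>n. \<forall>x\<in>C n. d (n + 1) (d n x) = 0)"

definition cochain_map ::
    "('k::field \<Rightarrow> 'x::ab_group_add \<Rightarrow> 'x) \<Rightarrow> (int \<Rightarrow> 'x set) \<Rightarrow> (int \<Rightarrow> 'x \<Rightarrow> 'x)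
      \<Rightarrow> ('k \<Rightarrow> 'y::ab_group_add \<Rightarrow> 'y) \<Rightarrow> (int \<Rightarrow> 'y set) \<Rightarrow> (int \<Rightarrow> 'y \<Rightarrow> 'y)
      \<Rightarrow> (int \<Rightarrow> 'x \<Rightarrow> 'y) \<Rightarrow> bool"
  where "cochain_map s C d t D e f \<longleftrightarrow>
    (\<forall>n. linear_map_on s t (C n) (D n) (f n)) \<and>
    (\<forall>n. \<forall>x\<in>C n. f (n + 1) (d n x) = e n (f n x))"

definition short_exact_complexes ::
    "('k::field \<Rightarrow> 'x::ab_group_add \<Rightarrow> 'x) \<Rightarrow> (int \<Rightarrow> 'x set) \<Rightarrow> (int \<Rightarrow> 'x \<Rightarrow> 'x)
      \<Rightarrow> ('k \<Rightarrow> 'y::ab_group_add \<Rightarrow> 'y) \<Rightarrow> (int \<Rightarrow> 'y set) \<Rightarrow> (int \<Rightarrow> 'y \<Rightarrow> 'y)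
      \<Rightarrow> ('k \<Rightarrow> 'z::ab_group_add \<Rightarrow> 'z) \<Rightarrow> (int \<Rightarrow> 'z set) \<Rightarrow> (int \<Rightarrow> 'z \<Rightarrow> 'z)
      \<Rightarrow> (int \<Rightarrow> 'x \<Rightarrow> 'y) \<Rightarrow> (int \<Rightarrow> 'y \<Rightarrow> 'z) \<Rightarrow> bool"
  where "short_exact_complexes s C dC t D dD u E dE \<iota> \<pi> \<longleftrightarrow>
    cochain_complex s C dC \<and> cochain_complex t D dD \<and> cochain_complex u E dE \<and>
    cochain_map s C dC t D dD \<iota> \<and> cochain_map t D dD u E dE \<pi> \<and>
    (\<forall>n. {x \<in> C n. \<iota> n x = 0} = {0}) \<and>
    (\<forall>n. \<iota> n ` C n = {y \<in> D n. \<pi> n y = 0}) \<and>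
    (\<forall>n. \<pi> n ` D n = E n)"

section \<open>Degree zero\<close>

lemma multilinear_maps_0:
  "multilinear_maps sA sV 0 = range (\<lambda>v xs. if xs = [] then v else 0)"
proof -
  have "f \<in> range (\<lambda>v xs. if xs = [] then v else 0)"
    if "f \<in> multilinear_maps sA sV 0" for f
    using that by (intro image_eqI[where x = "f []"]) (auto simp: multilinear_maps_def)
  then show ?thesis
    by (auto simp: multilinear_maps_def)
qed

lemma hochschild_degree_0:
  assumes "vector_space sV"
  shows "hochschild sV l r (\<lambda>xs. if xs = [] then v else 0) [x] = l x v - r v x"
proof -
  interpret vector_space sV by fact
  show ?thesis by (simp add: hochschild_def)
qed

lemma delta_degree_0: "delta lam dA sV dV (\<lambda>xs. if xs = [] then v else 0) [] = - dV v"
  by (simp add: delta_def)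

end

theory Submission
  imports Defs
begin

text \<open>
  Exactness and the compatibility of \<open>\<iota>\<close> and \<open>\<pi>\<close> with the differentials are immediate; the content is
  that the middle row is a complex, which amounts to \<open>\<partial>\<partial> = 0\<close>, \<open>\<partial>\<^sub>\<lambda>\<partial>\<^sub>\<lambda> = 0\<close> and \<open>\<partial>\<^sub>\<lambda>\<delta> = \<delta>\<partial>\<close>.
  The map \<open>\<phi> = id + \<lambda> d\<close> is an algebra endomorphism, so \<open>\<partial>\<^sub>\<lambda>\<close> is the Hochschild coboundary of
  the bimodule twisted by \<open>\<phi>\<close>. Collecting the terms of \<open>\<delta> f\<close> by the smallest index at which
  \<open>d\<close> is applied gives \<open>\<Sum>\<^sub>j f(x\<^sub>1, \<dots>, d x\<^sub>j, \<phi> x\<^sub>j\<^sub>+\<^sub>1, \<dots>, \<phi> x\<^sub>n) - d(f(x\<^sub>1, \<dots>, x\<^sub>n))\<close>, and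
  \<open>d(xy) = d x \<phi>(y) + x d y\<close> makes this commute with every inner face map. The outer faces
  match because \<open>f(\<phi> x\<^sub>1, \<dots>, \<phi> x\<^sub>n) - f(x\<^sub>1, \<dots>, x\<^sub>n)\<close> is \<open>\<lambda>\<close> times that sum. Peeling off the first
  argument turns the alternating sums into recursions on the argument list.
\<close>

section \<open>Multilinearity one argument at a time\<close>

lemma multilinear_maps_0_iff: "f \<in> multilinear_maps sA sV 0 \<longleftrightarrow> (\<forall>xs. xs \<noteq> [] \<longrightarrow> f xs = 0)"
  by (simp add: multilinear_maps_def)

text \<open>Updating position 0 replaces the head and updating \<open>Suc i\<close> touches only the
  tail, so multilinearity can be proved by induction on the degree. The slices do not see the empty
  list, hence the clause \<open>f [] = 0\<close>.\<close>

lemma multilinear_maps_Suc_iff: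
  "f \<in> multilinear_maps sA sV (Suc n) \<longleftrightarrow>
    f [] = 0 \<and> (\<forall>x. (\<lambda>xs. f (x # xs)) \<in> multilinear_maps sA sV n) \<and>
    (\<forall>xs. length xs = n \<longrightarrow> Vector_Spaces.linear sA sV (\<lambda>x. f (x # xs)))"
  (is "_ \<longleftrightarrow> ?R")
proof
  assume f: "f \<in> multilinear_maps sA sV (Suc n)"
  then have lin: "Vector_Spaces.linear sA sV (\<lambda>x. f (xs[i := x]))"
    if "length xs = Suc n" "i < Suc n" for xs i
    using that by (simp add: multilinear_maps_def)
  show ?R
    \<comment> \<open>The entry at position 0 is overwritten, so any placeholder serves as
      head.\<close>
    using f lin[of "_ # _" "Suc _"] lin[of "undefined # _" 0]
    by (auto simp: multilinear_maps_def)
next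
  assume R: ?R
  have "f xs = 0" if "length xs \<noteq> Suc n" for xs
    using R that by (cases xs) (auto simp: multilinear_maps_def)
  moreover have "Vector_Spaces.linear sA sV (\<lambda>x. f (xs[i := x]))"
    if "length xs = Suc n" "i < Suc n" for xs i
    using R that by (cases xs; cases i) (auto simp: multilinear_maps_def)
  ultimately show "f \<in> multilinear_maps sA sV (Suc n)"
    by (simp add: multilinear_maps_def)
qed

lemma multilinear_maps_eq_0:
  "f \<in> multilinear_maps sA sV n \<Longrightarrow> length xs \<noteq> n \<Longrightarrow> f xs = 0"
  by (simp add: multilinear_maps_def)

section \<open>Recursive forms of the coboundary and of \<open>delta\<close>\<close>

text \<open>
  The Hochschild coboundary without its term \<open>x\<^sub>1 f(x\<^sub>2, \<dots>)\<close> and with the opposite sign. The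
  recursion splits off the face map multiplying the first two entries; the remaining faces fix
  the first entry.
\<close>

fun right_bar ::
    "('v \<Rightarrow> 'a::ring \<Rightarrow> 'v) \<Rightarrow> ('a list \<Rightarrow> 'v) \<Rightarrow> 'a list \<Rightarrow> 'v::ab_group_add"
  where
    "right_bar r f [] = 0"
  | "right_bar r f [x] = r (f []) x"
  | "right_bar r f (x # y # zs) = f (x * y # zs) - right_bar r (\<lambda>w. f (x # w)) (y # zs)"

text \<open>
  \<open>\<Sum>\<^sub>j f(x\<^sub>1, \<dots>, x\<^sub>j\<^sub>-\<^sub>1, d x\<^sub>j, p x\<^sub>j\<^sub>+\<^sub>1, \<dots>, p x\<^sub>n)\<close>. For \<open>p = id + \<lambda> d\<close> this is the sum over
  nonempty index sets in \<open>delta\<close>, collected by the smallest index.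
\<close>

primrec telescope ::
    "('a \<Rightarrow> 'a) \<Rightarrow> ('a \<Rightarrow> 'a) \<Rightarrow> ('a list \<Rightarrow> 'v) \<Rightarrow> 'a list \<Rightarrow> 'v::ab_group_add"
  where
    "telescope d p f [] = 0"
  | "telescope d p f (x # xs) = f (d x # map p xs) + telescope d p (\<lambda>w. f (x # w)) xs"

text \<open>\<open>f\<close> is evaluated only on lists one entry shorter than \<open>xs\<close>, so
  identities restricted to nonempty lists can still rewrite it.\<close>

lemma right_bar_cong:
  "(\<And>w. Suc (length w) = length xs \<Longrightarrow> f w = g w) \<Longrightarrow> right_bar r f xs = right_bar r g xs"
proof (induction xs arbitrary: f g rule: induct_list012)
  case (3 x y zs)
  have "right_bar r (\<lambda>w. f (x # w)) (y # zs) = right_bar r (\<lambda>w. g (x # w)) (y # zs)"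
    by (rule "3.IH") (simp add: "3.prems")
  then show ?case
    by (simp add: "3.prems")
qed auto

lemma telescope_cong:
  "(\<And>w. length w = length xs \<Longrightarrow> f w = g w) \<Longrightarrow> telescope d p f xs = telescope d p g xs"
proof (induction xs arbitrary: f g)
  case (Cons x xs)
  have "telescope d p (\<lambda>w. f (x # w)) xs = telescope d p (\<lambda>w. g (x # w)) xs"
    by (rule Cons.IH) (simp add: Cons.prems)
  then show ?case
    by (simp add: Cons.prems)
qed auto

lemma telescope_eq_0: "(\<And>w. length w = length xs \<Longrightarrow> f w = 0) \<Longrightarrow> telescope d p f xs = 0"
  by (induction xs arbitrary: f) simp_all

text \<open>A multiplicative \<open>p\<close> commutes with the faces multiplying neighbours; in the
  last face the twisted action supplies the missing \<open>p\<close>.\<close>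

lemma right_bar_map:
  assumes "\<And>x y. p (x * y) = p x * p y"
  shows "right_bar (\<lambda>v x. r v (p x)) (\<lambda>w. f (map p w)) xs = right_bar r f (map p xs)"
proof (induction xs arbitrary: f rule: induct_list012)
  case (3 x y zs)
  show ?case
    using "3.IH"(2)[of "\<lambda>w. f (p x # w)"] by (simp add: assms)
qed simp_all

text \<open>The minus sign in the recursion accounts for the shift of the exponent in
  \<open>(-1) ^ i\<close>.\<close>

lemma right_bar_closed_form:
  assumes "vector_space sV" "length xs = Suc n"
  shows "right_bar r f xs =
    (\<Sum>i<n. sV ((-1) ^ i) (f (take i xs @ [xs ! i * xs ! Suc i] @ drop (Suc (Suc i)) xs)))
    + sV ((-1) ^ n) (r (f (butlast xs)) (last xs))"
  using assms(2)
proof (induction xs arbitrary: f n rule: induct_list012)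
  case (2 x)
  interpret vector_space sV by fact
  from 2 show ?case by simp
next
  case (3 x y zs)
  interpret vector_space sV by fact
  from "3.prems" obtain m where m: "n = Suc m" "length (y # zs) = Suc m" by auto
  show ?case
    unfolding right_bar.simps "3.IH"(2)[OF m(2)] m(1) sum.lessThan_Suc_shift
    by (simp add: sum_negf)
qed simp

text \<open>The sum in \<open>hochschild\<close> starts at 1 and the closed form at 0; this shift
  flips every sign, hence the subtraction.\<close>

lemma hochschild_Cons:
  assumes "vector_space sV"
  shows "hochschild sV l r f (x # xs) = l x (f xs) - right_bar r f (x # xs)"
proof -
  interpret vector_space sV by fact
  show ?thesis
    unfolding hochschild_def Let_def
    by (simp add: right_bar_closed_form[OF assms, of _ "length xs"] sum.atLeast1_atMost_eq sum_negf)
qed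

lemma hochschild_Nil: "hochschild sV l r f [] = 0"
  by (simp add: hochschild_def)

text \<open>Splitting by whether 0 belongs to the index set mirrors splitting a list into head and
  tail.\<close>

lemma sum_subsets_lessThan_Suc:
  fixes F :: "nat set \<Rightarrow> 'b::comm_monoid_add"
  shows "(\<Sum>I | I \<subseteq> {0..<Suc n}. F I) =
    (\<Sum>I | I \<subseteq> {0..<n}. F (Suc ` I)) + (\<Sum>I | I \<subseteq> {0..<n}. F (insert 0 (Suc ` I)))"
proof -
  have ins: "{0..<Suc n} = insert 0 (Suc ` {0..<n})"
    by (simp only: lessThan_atLeast0 [symmetric] lessThan_Suc_eq_insert_0)
  have "Pow {0..<Suc n} = (image Suc) ` Pow {0..<n} \<union> (\<lambda>I. insert 0 (Suc ` I)) ` Pow {0..<n}"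
    unfolding ins Pow_insert image_Pow_surj[of Suc "{0..<n}", OF refl, symmetric] image_image ..
  then have "sum F (Pow {0..<Suc n})
      = sum F ((image Suc) ` Pow {0..<n} \<union> (\<lambda>I. insert 0 (Suc ` I)) ` Pow {0..<n})"
    by (rule arg_cong)
  also have "\<dots> = sum F ((image Suc) ` Pow {0..<n}) + sum F ((\<lambda>I. insert 0 (Suc ` I)) ` Pow {0..<n})"
    by (rule sum.union_disjoint) auto
  also have "sum F ((image Suc) ` Pow {0..<n}) = sum (\<lambda>I. F (Suc ` I)) (Pow {0..<n})"
    by (rule sum.reindex_cong[where l = "image Suc"]) (auto intro: inj_on_image)
  also have "sum F ((\<lambda>I. insert 0 (Suc ` I)) ` Pow {0..<n}) = sum (\<lambda>I. F (insert 0 (Suc ` I))) (Pow {0..<n})"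
    \<comment> \<open>The preimage under \<open>Suc\<close> discards 0 and undoes the shift, so it
      is a left inverse.\<close>
    by (rule sum.reindex_cong[where l = "\<lambda>I. insert 0 (Suc ` I)"])
      (auto intro: inj_on_inverseI[where g = "\<lambda>I. Suc -` I"])
  finally show ?thesis
    unfolding Pow_def .
qed

lemmas linear_map_add = module_hom.add [OF Vector_Spaces.module_hom_linearI]
  and linear_map_diff = module_hom.diff [OF Vector_Spaces.module_hom_linearI]
  and linear_map_neg = module_hom.neg [OF Vector_Spaces.module_hom_linearI]
  and linear_map_scale = module_hom.scale [OF Vector_Spaces.module_hom_linearI]
  and linear_map_zero = module_hom.zero [OF Vector_Spaces.module_hom_linearI]

lemma telescope_add:
  "telescope d p (\<lambda>w. f w + g w) xs = telescope d p f xs + telescope d p g xs"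
  by (induction xs arbitrary: f g) simp_all

lemma telescope_diff:
  "telescope d p (\<lambda>w. f w - g w) xs = telescope d p f xs - telescope d p g xs"
  by (induction xs arbitrary: f g) simp_all

lemma (in vector_space) telescope_scale:
  "telescope d p (\<lambda>w. scale c (f w)) xs = scale c (telescope d p f xs)"
  by (induction xs arbitrary: f) (simp_all add: scale_right_distrib)

lemma linear_telescope:
  assumes "Vector_Spaces.linear s t h"
  shows "telescope d p (\<lambda>w. h (f w)) xs = h (telescope d p f xs)"
  by (induction xs arbitrary: f) (simp_all add: linear_map_zero[OF assms] linear_map_add[OF assms])

text \<open>Applied below to \<open>h = l x\<close>, where the intertwining condition is the
  bimodule law \<open>l_r_assoc\<close>.\<close>

lemma linear_right_bar:
  assumes "Vector_Spaces.linear s t h"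
    and "\<And>v x. h (r v x) = q (h v) x"
  shows "right_bar q (\<lambda>w. h (f w)) xs = h (right_bar r f xs)"
  by (induction xs arbitrary: f rule: induct_list012)
    (simp_all add: assms(2) linear_map_zero[OF assms(1)] linear_map_diff[OF assms(1)])

section \<open>The Hochschild complex of a bimodule\<close>

context algebra_bimodule begin

lemmas r_add = linear_map_add[OF linear_r_left] and r_diff = linear_map_diff[OF linear_r_left]
  and r_scale = linear_map_scale[OF linear_r_left] and r_zero = linear_map_zero[OF linear_r_left]
  and l_add = linear_map_add[OF linear_l_right] and l_diff = linear_map_diff[OF linear_l_right]
  and l_scale = linear_map_scale[OF linear_l_right] and l_zero = linear_map_zero[OF linear_l_right]
  and l_add_left = linear_map_add[OF linear_l_left] and l_scale_left = linear_map_scale[OF linear_l_left]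
  and r_add_right = linear_map_add[OF linear_r_right] and r_scale_right = linear_map_scale[OF linear_r_right]

lemma right_bar_add:
  "right_bar r (\<lambda>w. f w + g w) xs = right_bar r f xs + right_bar r g xs"
  by (induction xs arbitrary: f g rule: induct_list012) (simp_all add: r_add)

lemma right_bar_diff:
  "right_bar r (\<lambda>w. f w - g w) xs = right_bar r f xs - right_bar r g xs"
  by (induction xs arbitrary: f g rule: induct_list012) (simp_all add: r_diff)

lemma right_bar_scale: "right_bar r (\<lambda>w. sV c (f w)) xs = sV c (right_bar r f xs)"
  by (induction xs arbitrary: f rule: induct_list012)
    (simp_all add: r_scale V.scale_right_diff_distrib)

lemma right_bar_zero: "(\<And>w. f w = 0) \<Longrightarrow> right_bar r f xs = 0"
  by (induction xs arbitrary: f rule: induct_list012) (simp_all add: r_zero)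

text \<open>The recursion in a form that rewrites a bound variable \<open>w\<close> under
  \<open>right_bar_cong\<close> and \<open>telescope_cong\<close>.\<close>

lemma right_bar_slice:
  "w \<noteq> [] \<Longrightarrow> right_bar r f (x # w) = f (x * hd w # tl w) - right_bar r (\<lambda>w. f (x # w)) w"
  by (cases w) simp_all

text \<open>Once the induction hypothesis removes the double operator on the slice at
  \<open>x\<close>, the remaining terms cancel up to \<open>(x * y) * z\<close> against
  \<open>x * (y * z)\<close>.\<close>

lemma right_bar_right_bar: "right_bar r (right_bar r f) (x # y # zs) = 0"
proof (induction zs arbitrary: f x y)
  case Nil
  then show ?case by (simp add: r_mult)
next
  case (Cons z us)
  have "right_bar r (\<lambda>w. right_bar r f (x # w)) (y # z # us)
      = right_bar r (\<lambda>w. f (x * hd w # tl w) - right_bar r (\<lambda>w. f (x # w)) w) (y # z # us)"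
    by (intro right_bar_cong right_bar_slice) auto
  also have "\<dots> = right_bar r (\<lambda>w. f (x * hd w # tl w)) (y # z # us)"
    using Cons.IH by (simp only: right_bar_diff diff_zero)
  finally show ?case
    by (simp add: mult.assoc)
qed

text \<open>With the square of \<open>right_bar\<close> gone, the terms
  \<open>l x (right_bar r f (y # zs))\<close> cancel, and \<open>l_mult\<close> cancels
  \<open>l (x * y)\<close> against \<open>l x\<close> after \<open>l y\<close>.\<close>

lemma hochschild_hochschild: "hochschild sV l r (hochschild sV l r f) xs = 0"
proof (induction xs rule: induct_list012)
  case (3 x y zs)
  have "right_bar r (hochschild sV l r f) (x # y # zs)
      = right_bar r (\<lambda>w. l (hd w) (f (tl w)) - right_bar r f w) (x # y # zs)"
    by (intro right_bar_cong) (auto simp: hochschild_Cons[OF V.vector_space_axioms] length_Suc_conv)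
  also have "\<dots> = right_bar r (\<lambda>w. l (hd w) (f (tl w))) (x # y # zs)"
    by (simp only: right_bar_diff right_bar_right_bar diff_zero)
  also have "\<dots> = l (x * y) (f zs) - l x (right_bar r f (y # zs))"
    by (simp add: linear_right_bar[OF linear_l_right, of _ r] l_r_assoc)
  finally show ?case
    by (simp add: hochschild_Cons[OF V.vector_space_axioms] l_mult l_diff del: right_bar.simps)
qed (simp_all add: hochschild_Nil hochschild_Cons[OF V.vector_space_axioms] l_zero r_zero)

lemma hochschild_add:
  "hochschild sV l r (f + g) = hochschild sV l r f + hochschild sV l r g"
proof
  show "hochschild sV l r (f + g) xs = (hochschild sV l r f + hochschild sV l r g) xs" for xs
    by (cases xs) (simp_all add: hochschild_Nil hochschild_Cons[OF V.vector_space_axioms]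
        l_add right_bar_add plus_fun_def)
qed

lemma hochschild_zero: "hochschild sV l r 0 = 0"
  using hochschild_add[of 0 0] by simp

lemma hochschild_scale:
  "hochschild sV l r (scale_fun sV c f) = scale_fun sV c (hochschild sV l r f)"
proof
  show "hochschild sV l r (scale_fun sV c f) xs = scale_fun sV c (hochschild sV l r f) xs" for xs
    by (cases xs) (simp_all add: hochschild_Nil hochschild_Cons[OF V.vector_space_axioms]
        l_scale right_bar_scale V.scale_right_diff_distrib scale_fun_def)
qed

lemma linear_minus:
  assumes "Vector_Spaces.linear sA sV f" "Vector_Spaces.linear sA sV g"
  shows "Vector_Spaces.linear sA sV (\<lambda>x. f x - g x)"
  using assms by (simp add: Vector_Spaces.linear_iff algebra_simps V.scale_right_diff_distrib)

lemma linear_plus: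
  assumes "Vector_Spaces.linear sA sV f" "Vector_Spaces.linear sA sV g"
  shows "Vector_Spaces.linear sA sV (\<lambda>x. f x + g x)"
  using assms by (simp add: Vector_Spaces.linear_iff algebra_simps V.scale_right_distrib)

lemma multilinear_maps_diff:
  assumes "f \<in> multilinear_maps sA sV n" "g \<in> multilinear_maps sA sV n"
  shows "(\<lambda>w. f w - g w) \<in> multilinear_maps sA sV n"
  using assms by (auto simp: multilinear_maps_def Vector_Spaces.linear_iff algebra_simps V.scale_right_diff_distrib)

lemma multilinear_maps_add:
  assumes "f \<in> multilinear_maps sA sV n" "g \<in> multilinear_maps sA sV n"
  shows "(\<lambda>w. f w + g w) \<in> multilinear_maps sA sV n"
  using assms by (auto simp: multilinear_maps_def Vector_Spaces.linear_iff algebra_simps V.scale_right_distrib)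

lemma multilinear_maps_zero: "(\<lambda>w. 0) \<in> multilinear_maps sA sV n"
  by (auto simp: multilinear_maps_def Vector_Spaces.linear_iff A.vector_space_axioms V.vector_space_axioms)

lemma multilinear_maps_compose:
  assumes "f \<in> multilinear_maps sA sV n" "Vector_Spaces.linear sV sV h"
  shows "(\<lambda>w. h (f w)) \<in> multilinear_maps sA sV n"
  using assms by (auto simp: multilinear_maps_def Vector_Spaces.linear_iff linear_map_zero[OF assms(2)])

lemma multilinear_maps_map:
  assumes "Vector_Spaces.linear sA sA p"
  shows "f \<in> multilinear_maps sA sV n \<Longrightarrow> (\<lambda>w. f (map p w)) \<in> multilinear_maps sA sV n"
  using assms by (auto simp: multilinear_maps_def Vector_Spaces.linear_iff map_update)

text \<open>For \<open>w\<close> of the wrong length the map is zero, so linearity rules apply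
  without tracking lengths.\<close>

lemma multilinear_maps_Cons_linear:
  assumes "f \<in> multilinear_maps sA sV n"
  shows "Vector_Spaces.linear sA sV (\<lambda>x. f (x # w))"
proof (cases "Suc (length w) = n")
  case False
  then have "(\<lambda>x. f (x # w)) = (\<lambda>_. 0)"
    using assms by (auto simp: multilinear_maps_eq_0)
  then show ?thesis
    by (simp add: Vector_Spaces.linear_iff A.vector_space_axioms V.vector_space_axioms)
qed (use assms in \<open>auto simp: multilinear_maps_Suc_iff\<close>)

text \<open>For \<open>n = 0\<close> the slice is zero, so inductions on the argument list avoid a
  case split on the degree.\<close>

lemma multilinear_maps_Cons_pred:
  "f \<in> multilinear_maps sA sV n \<Longrightarrow> (\<lambda>w. f (x # w)) \<in> multilinear_maps sA sV (n - 1)"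
  by (cases n) (simp_all add: multilinear_maps_Suc_iff multilinear_maps_0_iff multilinear_maps_zero)

lemma multilinear_maps_Cons:
  "f \<in> multilinear_maps sA sV (Suc n) \<Longrightarrow> (\<lambda>w. f (x # w)) \<in> multilinear_maps sA sV n"
  by (simp add: multilinear_maps_Suc_iff)

lemmas multilinear_maps_Cons_add = linear_map_add[OF multilinear_maps_Cons_linear]
  and multilinear_maps_Cons_scale = linear_map_scale[OF multilinear_maps_Cons_linear]

lemma linear_mult_left: "Vector_Spaces.linear sA sA (\<lambda>x. x * y)"
  and linear_mult_right: "Vector_Spaces.linear sA sA (\<lambda>y. x * y)"
  by (auto simp: Vector_Spaces.linear_iff A.vector_space_axioms algebra_simps A.mult_scale_left A.mult_scale_right)

lemma right_bar_multilinear: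
  "f \<in> multilinear_maps sA sV n \<Longrightarrow> right_bar r f \<in> multilinear_maps sA sV (Suc n)"
proof (induction n arbitrary: f)
  case 0
  then have f: "f w = 0" if "w \<noteq> []" for w using that by (simp add: multilinear_maps_0_iff)
  have bar: "right_bar r f (x # w) = (if w = [] then r (f []) x else 0)" for x w
    by (cases w) (auto simp: f intro: right_bar_zero)
  show ?case
    unfolding multilinear_maps_Suc_iff bar
    by (auto simp: multilinear_maps_0_iff linear_r_right)
next
  case (Suc n)
  \<comment> \<open>The face multiplying the first two entries. The default 0 makes
    \<open>bar\<close> hold for \<open>w = []\<close> as well, since \<open>f [] = 0\<close> in
    positive degree.\<close>
  define g where "g x w = (if w = [] then 0 else f (x * hd w # tl w))" for x w
  have bar: "right_bar r f (x # w) = g x w - right_bar r (\<lambda>w. f (x # w)) w" for x w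
    using Suc.prems by (cases w) (simp_all add: g_def multilinear_maps_eq_0 r_zero)
  have "g x \<in> multilinear_maps sA sV (Suc n)" for x
    using Suc.prems multilinear_maps_Cons_linear[OF Suc.prems] linear_mult_right[of x]
    by (simp add: multilinear_maps_Suc_iff[of "g x"] g_def multilinear_maps_Cons Vector_Spaces.linear_iff)
  moreover have "Vector_Spaces.linear sA sV (\<lambda>x. g x w)" for w
    using multilinear_maps_Cons_linear[OF Suc.prems] linear_mult_left[of "hd w"]
    by (simp add: g_def Vector_Spaces.linear_iff)
  moreover have "Vector_Spaces.linear sA sV (\<lambda>x. right_bar r (\<lambda>w. f (x # w)) w)" for w
    by (simp add: Vector_Spaces.linear_iff A.vector_space_axioms V.vector_space_axioms
        multilinear_maps_Cons_add[OF Suc.prems] multilinear_maps_Cons_scale[OF Suc.prems]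
        right_bar_add right_bar_scale)
  ultimately show ?case
    unfolding multilinear_maps_Suc_iff[of "right_bar r f"] bar
    by (auto intro!: multilinear_maps_diff linear_minus Suc.IH multilinear_maps_Cons[OF Suc.prems])
qed

lemma hochschild_multilinear:
  assumes f: "f \<in> multilinear_maps sA sV n"
  shows "hochschild sV l r f \<in> multilinear_maps sA sV (Suc n)"
proof -
  define g where "g w = (if w = [] then 0 else l (hd w) (f (tl w)))" for w
  have "hochschild sV l r f = (\<lambda>w. g w - right_bar r f w)"
  proof
    show "hochschild sV l r f w = g w - right_bar r f w" for w
      by (cases w) (simp_all add: g_def hochschild_Nil hochschild_Cons[OF V.vector_space_axioms])
  qed
  moreover have "g \<in> multilinear_maps sA sV (Suc n)"
    using multilinear_maps_compose[OF f linear_l_right] linear_l_left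
    by (simp add: multilinear_maps_Suc_iff[of g] g_def)
  ultimately show ?thesis
    by (simp add: multilinear_maps_diff right_bar_multilinear f)
qed

end

section \<open>The closed form of \<open>delta\<close>\<close>

definition replace_at :: "('a \<Rightarrow> 'a) \<Rightarrow> nat set \<Rightarrow> 'a list \<Rightarrow> 'a list"
  where "replace_at d I xs = map (\<lambda>i. if i \<in> I then d (xs ! i) else xs ! i) [0..<length xs]"

lemma replace_at_Cons:
  "replace_at d (Suc ` I) (x # xs) = x # replace_at d I xs"
  "replace_at d (insert 0 (Suc ` I)) (x # xs) = d x # replace_at d I xs"
proof -
  have "[0..<length (x # xs)] = 0 # map Suc [0..<length xs]"
    by (simp add: upt_conv_Cons map_Suc_upt del: upt_Suc)
  then show "replace_at d (Suc ` I) (x # xs) = x # replace_at d I xs"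
    and "replace_at d (insert 0 (Suc ` I)) (x # xs) = d x # replace_at d I xs"
    by (auto simp: replace_at_def simp del: upt_Suc)
qed

lemma subset_atLeast0_finite: "I \<subseteq> {0..<n::nat} \<Longrightarrow> finite I"
  by (rule finite_subset) auto

context differential_bimodule begin

abbreviation phi :: "'a \<Rightarrow> 'a"
  where "phi x \<equiv> x + sA lam (dA x)"

lemmas dA_add = linear_map_add[OF linear_dA] and dA_scale = linear_map_scale[OF linear_dA]
  and dV_add = linear_map_add[OF linear_dV] and dV_diff = linear_map_diff[OF linear_dV]
  and dV_scale = linear_map_scale[OF linear_dV] and dV_zero = linear_map_zero[OF linear_dV]

lemma phi_mult: "phi (x * y) = phi x * phi y"
  by (simp add: dA_mult algebra_simps scale_right_distrib mult_scale_left mult_scale_right)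

lemma phi_linear: "Vector_Spaces.linear sA sA phi"
  by (simp add: Vector_Spaces.linear_iff vector_space_axioms dA_add dA_scale algebra_simps scale_right_distrib)

text \<open>Absorbing the weight term into the second factor makes \<open>dA\<close> a twisted
  derivation, matching \<open>telescope\<close>, where entries to the right of \<open>dA\<close>
  carry \<open>phi\<close>.\<close>

lemma dA_mult_phi: "dA (x * y) = dA x * phi y + x * dA y"
  by (simp add: dA_mult algebra_simps mult_scale_right)

text \<open>Multilinear expansion of the right-hand side: \<open>I\<close> records the arguments
  where the summand \<open>sA lam (dA x)\<close> of \<open>phi x\<close> is chosen.\<close>

lemma sum_replace_at_eq_map_phi:
  assumes "f \<in> multilinear_maps sA sV n" "length xs = n"
  shows "(\<Sum>I | I \<subseteq> {0..<n}. sV (lam ^ card I) (f (replace_at dA I xs))) = f (map phi xs)"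
  using assms
proof (induction xs arbitrary: f n)
  case Nil
  then show ?case by (simp add: replace_at_def)
next
  case (Cons x xs)
  then obtain m where n: "n = Suc m" "length xs = m" by auto
  note f = Cons.prems(1)[unfolded n(1)]
  have "(\<Sum>I | I \<subseteq> {0..<m}. sV (lam ^ card (insert 0 (Suc ` I))) (f (dA x # replace_at dA I xs)))
      = (\<Sum>I | I \<subseteq> {0..<m}. sV lam (sV (lam ^ card I) (f (dA x # replace_at dA I xs))))"
    by (intro sum.cong refl) (simp add: card_image subset_atLeast0_finite)
  also have "\<dots> = sV lam (f (dA x # map phi xs))"
    by (simp only: V.scale_sum_right[symmetric] Cons.IH[OF multilinear_maps_Cons[OF f] n(2)])
  finally show ?case
    by (simp add: n sum_subsets_lessThan_Suc replace_at_Cons card_image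
        Cons.IH[OF multilinear_maps_Cons[OF f] n(2)]
        multilinear_maps_Cons_add[OF f] multilinear_maps_Cons_scale[OF f])
qed

text \<open>Sets containing 0 have the head as smallest index and sum to its term by the expansion
  above; the others recurse into the tail. Keeping the empty set with value 0 lets the sum range
  over all subsets.\<close>

lemma sum_replace_at_eq_telescope:
  assumes "f \<in> multilinear_maps sA sV n" "length xs = n"
  shows "(\<Sum>I | I \<subseteq> {0..<n}. if I = {} then 0 else sV (lam ^ (card I - 1)) (f (replace_at dA I xs)))
    = telescope dA phi f xs"
  using assms
proof (induction xs arbitrary: f n)
  case Nil
  then show ?case by simp
next
  case (Cons x xs)
  then obtain m where n: "n = Suc m" "length xs = m" by auto
  note f = Cons.prems(1)[unfolded n(1)]
  have "(\<Sum>I | I \<subseteq> {0..<m}. sV (lam ^ (card (insert 0 (Suc ` I)) - 1)) (f (dA x # replace_at dA I xs)))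
      = (\<Sum>I | I \<subseteq> {0..<m}. sV (lam ^ card I) (f (dA x # replace_at dA I xs)))"
    by (intro sum.cong refl) (simp add: card_image subset_atLeast0_finite)
  also have "\<dots> = f (dA x # map phi xs)"
    by (rule sum_replace_at_eq_map_phi[OF multilinear_maps_Cons[OF f] n(2)])
  finally show ?case
    using Cons.IH[OF multilinear_maps_Cons[OF f] n(2)]
    by (simp add: n sum_subsets_lessThan_Suc replace_at_Cons card_image cong: if_cong)
qed

lemma delta_eq_telescope:
  assumes f: "f \<in> multilinear_maps sA sV n"
  shows "delta lam dA sV dV f xs = telescope dA phi f xs - dV (f xs)"
proof (cases "length xs = n")
  case True
  have "(\<Sum>I | I \<subseteq> {0..<n}. if I = {} then 0 else sV (lam ^ (card I - 1)) (f (replace_at dA I xs)))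
      = (\<Sum>I | I \<subseteq> {0..<n} \<and> I \<noteq> {}. sV (lam ^ (card I - 1)) (f (replace_at dA I xs)))"
    by (rule sum.mono_neutral_cong_right) auto
  \<comment> \<open>Grouping by cardinality recovers the double sum of \<open>delta\<close>;
    nonempty index sets have sizes from 1 to \<open>n\<close>.\<close>
  also have "\<dots> = (\<Sum>k=1..n. \<Sum>I | I \<in> {I. I \<subseteq> {0..<n} \<and> I \<noteq> {}} \<and> card I = k.
      sV (lam ^ (card I - 1)) (f (replace_at dA I xs)))"
  proof (rule sum.group[symmetric])
    show "card ` {I. I \<subseteq> {0..<n} \<and> I \<noteq> {}} \<subseteq> {1..n}"
    proof clarsimp
      fix I assume "I \<subseteq> {0..<n}" "I \<noteq> {}"
      then show "Suc 0 \<le> card I \<and> card I \<le> n"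
        using card_mono[of "{0..<n}" I] by (auto simp: Suc_le_eq card_gt_0_iff subset_atLeast0_finite)
    qed
  qed auto
  also have "\<dots> = (\<Sum>k=1..n. sV (lam ^ (k - 1)) (\<Sum>I | I \<subseteq> {0..<n} \<and> card I = k. f (replace_at dA I xs)))"
    unfolding V.scale_sum_right by (intro sum.cong refl) auto
  finally show ?thesis
    by (simp add: delta_def replace_at_def True sum_replace_at_eq_telescope[OF f True, symmetric])
next
  case False
  then show ?thesis
    using f by (simp add: delta_def multilinear_maps_eq_0 telescope_eq_0)
qed

lemma telescope_multilinear:
  "f \<in> multilinear_maps sA sV n \<Longrightarrow> telescope dA phi f \<in> multilinear_maps sA sV n"
proof (induction n arbitrary: f)
  case 0
  have "telescope dA phi f xs = 0" if "length xs \<noteq> 0" for xs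
    using that by (intro telescope_eq_0 multilinear_maps_eq_0[OF 0]) simp
  then show ?case by (simp add: multilinear_maps_0_iff)
next
  case (Suc n)
  have "Vector_Spaces.linear sA sV (\<lambda>x. f (dA x # w))" for w
    using linear_dA multilinear_maps_Cons_linear[OF Suc.prems] by (simp add: Vector_Spaces.linear_iff)
  moreover have "Vector_Spaces.linear sA sV (\<lambda>x. telescope dA phi (\<lambda>w. f (x # w)) w)" for w
    by (simp add: Vector_Spaces.linear_iff vector_space_axioms V.vector_space_axioms
        multilinear_maps_Cons_add[OF Suc.prems] multilinear_maps_Cons_scale[OF Suc.prems]
        telescope_add V.telescope_scale)
  ultimately show ?case
    unfolding multilinear_maps_Suc_iff[of "telescope dA phi f"] telescope.simps
    by (auto intro!: multilinear_maps_add linear_plus Suc.IH multilinear_maps_Cons[OF Suc.prems]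
       multilinear_maps_map[OF phi_linear, of "\<lambda>w. f (_ # w)"])
qed

lemma delta_multilinear:
  assumes f: "f \<in> multilinear_maps sA sV n"
  shows "delta lam dA sV dV f \<in> multilinear_maps sA sV n"
  using multilinear_maps_diff[OF telescope_multilinear[OF f] multilinear_maps_compose[OF f linear_dV]]
  by (simp add: delta_eq_telescope[OF f, abs_def])

section \<open>Compatibility of \<open>delta\<close> with the coboundaries\<close>

text \<open>Applying \<open>phi\<close> to one more entry changes the value by \<open>lam\<close>
  times one summand of \<open>telescope\<close>.\<close>

lemma map_phi_eq_telescope:
  "f \<in> multilinear_maps sA sV n \<Longrightarrow> f (map phi xs) = f xs + sV lam (telescope dA phi f xs)"
proof (induction xs arbitrary: f n)
  case (Cons x xs)
  note f = Cons.prems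
  show ?case
    using Cons.IH[OF multilinear_maps_Cons_pred[OF f], of x]
    by (simp add: multilinear_maps_Cons_add[OF f] multilinear_maps_Cons_scale[OF f] V.scale_right_distrib)
qed simp

text \<open>This is restriction of scalars along the endomorphism \<open>phi\<close>, so all facts
  on \<open>hochschild\<close> transfer to \<open>hochschild_lam\<close>.\<close>

lemma algebra_bimodule_lam:
  "algebra_bimodule sA sV (left_lam sA lam dA l) (right_lam sA lam dA r)"
proof (intro algebra_bimodule.intro algebra_bimodule_axioms.intro)
  show "left_lam sA lam dA l (x * y) v = left_lam sA lam dA l x (left_lam sA lam dA l y v)" for x y v
    unfolding left_lam_def phi_mult l_mult ..
  show "right_lam sA lam dA r v (x * y) = right_lam sA lam dA r (right_lam sA lam dA r v x) y" for x y v
    unfolding right_lam_def phi_mult r_mult ..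
  show "right_lam sA lam dA r (left_lam sA lam dA l x v) y = left_lam sA lam dA l x (right_lam sA lam dA r v y)" for x y v
    by (simp only: left_lam_def right_lam_def l_r_assoc)
  show "Vector_Spaces.linear sA sV (\<lambda>x. left_lam sA lam dA l x v)" for v
    using Vector_Spaces.linear_compose[OF phi_linear linear_l_left[of v]] by (simp add: left_lam_def o_def)
  show "Vector_Spaces.linear sA sV (\<lambda>x. right_lam sA lam dA r v x)" for v
    using Vector_Spaces.linear_compose[OF phi_linear linear_r_right[of v]] by (simp add: right_lam_def o_def)
qed (simp_all only: left_lam_def right_lam_def linear_l_right linear_r_left
    assoc_algebra_axioms V.vector_space_axioms)

lemma right_bar_right_lam_map:
  "right_bar (right_lam sA lam dA r) (\<lambda>w. f (map phi w)) xs = right_bar r f (map phi xs)"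
  using right_bar_map[of phi r f xs] phi_mult by (simp add: right_lam_def[abs_def])

abbreviation tdelta :: "('a list \<Rightarrow> 'v) \<Rightarrow> 'a list \<Rightarrow> 'v"
  where "tdelta f \<equiv> \<lambda>xs. telescope dA phi f xs - dV (f xs)"

text \<open>The one-entry case is \<open>dV_r\<close>. In the step, \<open>dA_mult_phi\<close>
  handles the first face and the induction hypothesis, applied to the slice at \<open>x\<close>, the
  others.\<close>

lemma tdelta_right_bar:
  "f \<in> multilinear_maps sA sV n \<Longrightarrow> tdelta (right_bar r f) xs = right_bar (right_lam sA lam dA r) (tdelta f) xs"
proof (induction xs arbitrary: f n rule: induct_list012)
  case 1
  then show ?case by (simp add: dV_zero)
next
  case (2 x)
  have "right_lam sA lam dA r (- dV (f [])) x = - (r (dV (f [])) x + sV lam (r (dV (f [])) (dA x)))"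
    unfolding right_lam_def by (simp add: linear_map_neg[OF linear_r_left] r_add_right r_scale_right)
  then show ?case by (simp add: dV_r)
next
  case (3 x y zs)
  interpret lam: algebra_bimodule sA sV "left_lam sA lam dA l" "right_lam sA lam dA r"
    by (rule algebra_bimodule_lam)
  note f = "3.prems"
  have "telescope dA phi (\<lambda>w. right_bar r f (x # w)) (y # zs)
      = telescope dA phi (\<lambda>w. f (x * hd w # tl w) - right_bar r (\<lambda>w. f (x # w)) w) (y # zs)"
    by (intro telescope_cong right_bar_slice) auto
  then have L: "telescope dA phi (\<lambda>w. right_bar r f (x # w)) (y # zs)
      = f (x * dA y # map phi zs) + telescope dA phi (\<lambda>w. f (x * y # w)) zs
        - telescope dA phi (right_bar r (\<lambda>w. f (x # w))) (y # zs)"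
    by (simp only: telescope_diff) simp
  \<comment> \<open>Unfolding \<open>tdelta f\<close> at the head separates the term with
    \<open>dA x\<close>, through which \<open>phi\<close> moves outward, from \<open>tdelta\<close>
    of the slice.\<close>
  have "right_bar (right_lam sA lam dA r) (\<lambda>w. tdelta f (x # w)) (y # zs)
      = right_bar (right_lam sA lam dA r) (\<lambda>w. f (dA x # map phi w) + tdelta (\<lambda>w. f (x # w)) w) (y # zs)"
    by (intro right_bar_cong) simp
  then have R: "right_bar (right_lam sA lam dA r) (\<lambda>w. tdelta f (x # w)) (y # zs)
      = right_bar r (\<lambda>w. f (dA x # w)) (phi y # map phi zs) + tdelta (right_bar r (\<lambda>w. f (x # w))) (y # zs)"
    using right_bar_right_lam_map[of "\<lambda>w. f (dA x # w)" "y # zs"]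
    by (simp only: lam.right_bar_add "3.IH"(2)[OF multilinear_maps_Cons_pred[OF f]] list.map)
  have add: "f (dA (x * y) # w) = f (dA x * phi y # w) + f (x * dA y # w)" for w
    by (simp only: dA_mult_phi multilinear_maps_Cons_add[OF f])
  have "tdelta (right_bar r f) (x # y # zs)
      = right_bar r f (dA x # phi y # map phi zs)
        + telescope dA phi (\<lambda>w. right_bar r f (x # w)) (y # zs) - dV (right_bar r f (x # y # zs))"
    by (simp only: telescope.simps list.map)
  also have "\<dots> = tdelta f (x * y # zs) - right_bar (right_lam sA lam dA r) (\<lambda>w. tdelta f (x # w)) (y # zs)"
    unfolding L R right_bar.simps(3)[of r f] telescope.simps(2)[of _ _ f "x * y"] add dV_diff
    by (simp only: algebra_simps)
  finally show ?case
    by (simp only: right_bar.simps)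
qed

lemma hochschild_lam_delta:
  assumes f: "f \<in> multilinear_maps sA sV n"
  shows "hochschild_lam sA lam dA sV l r (delta lam dA sV dV f) = delta lam dA sV dV (hochschild sV l r f)"
proof
  fix xs
  have tdelta: "delta lam dA sV dV f = tdelta f"
    "delta lam dA sV dV (hochschild sV l r f) = tdelta (hochschild sV l r f)"
    using delta_eq_telescope[OF f] delta_eq_telescope[OF hochschild_multilinear[OF f]] by auto
  show "hochschild_lam sA lam dA sV l r (delta lam dA sV dV f) xs = delta lam dA sV dV (hochschild sV l r f) xs"
  proof (cases xs)
    case Nil
    then show ?thesis
      by (simp add: tdelta hochschild_lam_def hochschild_Nil dV_zero)
  next
    case (Cons x w)
    have tel: "telescope dA phi (\<lambda>w. hochschild sV l r f (x # w)) w
        = l x (telescope dA phi f w) - telescope dA phi (\<lambda>w. right_bar r f (x # w)) w"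
      by (simp only: hochschild_Cons[OF V.vector_space_axioms] telescope_diff linear_telescope[OF linear_l_right])
    have "tdelta (hochschild sV l r f) (x # w) = l (dA x) (f (map phi w)) + l x (telescope dA phi f w)
        - dV (l x (f w)) - tdelta (right_bar r f) (x # w)"
      unfolding telescope.simps tel
      unfolding hochschild_Cons[OF V.vector_space_axioms] dV_diff
      by (simp only: algebra_simps)
    \<comment> \<open>Expanding \<open>f (map phi w)\<close> produces the \<open>lam\<close> term
      that completes \<open>l x\<close> to \<open>l (phi x)\<close>; \<open>dV_l\<close> does the
      same for the part with \<open>dV\<close>.\<close>
    also have "\<dots> = l (phi x) (tdelta f w) - right_bar (right_lam sA lam dA r) (tdelta f) (x # w)"
      unfolding tdelta_right_bar[OF f] map_phi_eq_telescope[OF f] dV_l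
      by (simp add: l_add l_add_left l_diff l_scale l_scale_left V.scale_right_diff_distrib)
    finally show ?thesis
      by (simp add: tdelta Cons hochschild_lam_def hochschild_Cons[OF V.vector_space_axioms] left_lam_def
          del: telescope.simps right_bar.simps)
  qed
qed

lemma delta_add: "delta lam dA sV dV (f + g) = delta lam dA sV dV f + delta lam dA sV dV g"
  by (rule ext) (simp add: delta_def Let_def sum.distrib V.scale_right_distrib dV_add)

lemma delta_scale:
  "delta lam dA sV dV (scale_fun sV c f) = scale_fun sV c (delta lam dA sV dV f)"
  by (rule ext) (simp add: delta_def Let_def scale_fun_def V.scale_right_diff_distrib dV_scale
      V.scale_sum_right mult.commute)

end

section \<open>The three complexes and the exact sequence\<close>

lemma (in vector_space) vector_space_scale_fun: "vector_space (scale_fun scale)"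
  by unfold_locales
    (auto simp: scale_fun_def plus_fun_def scale_right_distrib scale_left_distrib)

lemma cochain_complex_shift:
  assumes "cochain_complex s C d"
  shows "cochain_complex s (\<lambda>n. C (n - 1)) (\<lambda>n. d (n - 1))"
proof -
  have C: "vector_space s" "\<And>n. module.subspace s (C n)"
    "\<And>n. linear_map_on s s (C n) (C (n + 1)) (d n)" "\<And>n x. x \<in> C n \<Longrightarrow> d (n + 1) (d n x) = 0"
    using assms by (auto simp: cochain_complex_def)
  show ?thesis
    unfolding cochain_complex_def
    using C(1,2) C(3)[of "n - 1" for n] C(4)[of _ "n - 1" for n] by simp
qed

context algebra_bimodule begin

lemma subspace_C_Alg: "module.subspace (scale_fun sV) (C_Alg sA sV n)"
proof -
  interpret W: vector_space "scale_fun sV" by (rule V.vector_space_scale_fun)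
  show ?thesis
    unfolding W.subspace_def C_Alg_def
    using multilinear_maps_zero multilinear_maps_add multilinear_maps_compose[OF _ V.linear_scale_self]
    by (auto simp: zero_fun_def plus_fun_def scale_fun_def)
qed

lemma hochschild_C_Alg:
  assumes "f \<in> C_Alg sA sV n"
  shows "hochschild sV l r f \<in> C_Alg sA sV (n + 1)"
proof (cases "n < 0")
  case True
  interpret W: vector_space "scale_fun sV" by (rule V.vector_space_scale_fun)
  from True show ?thesis
    \<comment> \<open>Here \<open>f = 0\<close>; for \<open>n = -1\<close> the target is already the
      degree 0 space.\<close>
    using assms W.subspace_0[OF subspace_C_Alg] by (simp add: C_Alg_def[of _ _ n] hochschild_zero)
next
  case False
  then show ?thesis
    using assms hochschild_multilinear[of f "nat n"] by (simp add: C_Alg_def nat_add_distrib)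
qed

lemma cochain_complex_C_Alg: "cochain_complex (scale_fun sV) (C_Alg sA sV) (\<lambda>n. hochschild sV l r)"
  unfolding cochain_complex_def linear_map_on_def
  using V.vector_space_scale_fun subspace_C_Alg hochschild_C_Alg
  by (auto simp: hochschild_add hochschild_scale hochschild_hochschild fun_eq_iff)

end

context differential_bimodule begin

lemma cochain_complex_C_DO:
  "cochain_complex (scale_fun sV) (\<lambda>n. C_DO sA sV (n - 1)) (\<lambda>n. hochschild_lam sA lam dA sV l r)"
  using cochain_complex_shift[OF algebra_bimodule.cochain_complex_C_Alg[OF algebra_bimodule_lam]]
  by (simp add: C_DO_def[abs_def] hochschild_lam_def)

lemma delta_zero: "delta lam dA sV dV 0 = 0"
  using delta_add[of 0 0] by simp

lemma delta_C_Alg: "f \<in> C_Alg sA sV n \<Longrightarrow> delta lam dA sV dV f \<in> C_Alg sA sV n"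
  by (auto simp: C_Alg_def delta_zero delta_multilinear split: if_splits)

text \<open>On cochains the case distinction collapses: \<open>f\<close> and \<open>g\<close> vanish
  for \<open>n < 0\<close>, and \<open>g\<close> vanishes for \<open>n = 0\<close>.\<close>

lemma d_DA_eq:
  assumes "(f, g) \<in> C_DA sA sV n"
  shows "d_DA sA lam dA sV l r dV n (f, g) = (hochschild sV l r f,
    hochschild_lam sA lam dA sV l r g + scale_fun sV ((-1) ^ nat n) (delta lam dA sV dV f))"
proof -
  interpret lam: algebra_bimodule sA sV "left_lam sA lam dA l" "right_lam sA lam dA r"
    by (rule algebra_bimodule_lam)
  interpret W: vector_space "scale_fun sV" by (rule V.vector_space_scale_fun)
  show ?thesis
    using assms by (auto simp: d_DA_def C_DA_def C_DO_def C_Alg_def delta_zero zero_prod_def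
        hochschild_lam_def hochschild_zero lam.hochschild_zero)
qed

lemma hochschild_lam_delta_C_Alg:
  assumes "f \<in> C_Alg sA sV n"
  shows "hochschild_lam sA lam dA sV l r (delta lam dA sV dV f) = delta lam dA sV dV (hochschild sV l r f)"
proof -
  \<comment> \<open>In negative degree \<open>f = 0\<close>, which is treated as a cochain of degree
    0.\<close>
  have "0 \<in> multilinear_maps sA sV 0"
    using multilinear_maps_zero by (simp add: zero_fun_def)
  then show ?thesis
    using assms by (auto simp: C_Alg_def intro: hochschild_lam_delta split: if_splits)
qed

lemma cochain_complex_C_DA:
  "cochain_complex (module_prod.scale (scale_fun sV) (scale_fun sV)) (C_DA sA sV) (d_DA sA lam dA sV l r dV)"
proof -
  interpret lam: algebra_bimodule sA sV "left_lam sA lam dA l" "right_lam sA lam dA r"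
    by (rule algebra_bimodule_lam)
  interpret W: vector_space "scale_fun sV" by (rule V.vector_space_scale_fun)
  interpret P: vector_space_prod "scale_fun sV" "scale_fun sV" by unfold_locales
  have sub: "P.p.subspace (C_DA sA sV n)" for n
    unfolding C_DA_def C_DO_def by (intro P.subspace_Times subspace_C_Alg)
  let ?d = "d_DA sA lam dA sV l r dV"
  have into: "?d n z \<in> C_DA sA sV (n + 1)" if z: "z \<in> C_DA sA sV n" for n z
  proof -
    obtain f g where fg: "z = (f, g)" by (cases z)
    then have "hochschild_lam sA lam dA sV l r g \<in> C_Alg sA sV n"
      using z lam.hochschild_C_Alg[of g "n - 1"] by (simp add: hochschild_lam_def C_DA_def C_DO_def)
    with z show ?thesis
      unfolding fg d_DA_eq[OF z[unfolded fg]]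
      by (auto simp: C_DA_def C_DO_def hochschild_C_Alg
          intro!: W.subspace_add W.subspace_scale subspace_C_Alg delta_C_Alg)
  qed
  have add: "?d n (z + z') = ?d n z + ?d n z'"
    if z: "z \<in> C_DA sA sV n" "z' \<in> C_DA sA sV n" for n z z'
  proof -
    obtain f g f' g' where fg: "z = (f, g)" "z' = (f', g')" by (cases z, cases z')
    show ?thesis
      using z P.p.subspace_add[OF sub z]
      by (simp add: fg d_DA_eq hochschild_add lam.hochschild_add hochschild_lam_def delta_add
          W.scale_right_distrib)
  qed
  have scale: "?d n (P.scale c z) = P.scale c (?d n z)" if z: "z \<in> C_DA sA sV n" for n c z
  proof -
    obtain f g where fg: "z = (f, g)" by (cases z)
    show ?thesis
      using z P.p.subspace_scale[OF sub z, of c]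
      by (simp add: fg d_DA_eq P.scale_prod hochschild_scale lam.hochschild_scale hochschild_lam_def
          delta_scale W.scale_right_distrib mult.commute)
  qed
  have square: "?d (n + 1) (?d n z) = 0" if z: "z \<in> C_DA sA sV n" for n z
  proof -
    obtain f g where fg: "z = (f, g)" by (cases z)
    then have f: "f \<in> C_Alg sA sV n" using z by (simp add: C_DA_def)
    let ?h = "delta lam dA sV dV (hochschild sV l r f)"
    have cancel: "scale_fun sV ((-1) ^ nat n) ?h + scale_fun sV ((-1) ^ nat (n + 1)) ?h = 0"
    \<comment> \<open>For \<open>n < 0\<close> both exponents truncate to 0 and the signs do not
      alternate, but \<open>f = 0\<close>.\<close>
    proof (cases "n < 0")
      case True
      then have "f = 0" using f by (simp add: C_Alg_def)
      then show ?thesis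
        by (simp add: hochschild_zero delta_zero)
    qed (simp add: nat_add_distrib)
    have "hochschild sV l r (hochschild sV l r f) = 0"
      and "hochschild_lam sA lam dA sV l r (hochschild_lam sA lam dA sV l r g) = 0"
      by (simp_all add: fun_eq_iff hochschild_lam_def hochschild_hochschild lam.hochschild_hochschild)
    then show ?thesis
      using z into[OF z] cancel hochschild_lam_delta_C_Alg[OF f]
      by (simp add: fg d_DA_eq lam.hochschild_add lam.hochschild_scale hochschild_lam_def zero_prod_def)
  qed
  show ?thesis
    unfolding cochain_complex_def linear_map_on_def
    using P.p.vector_space_axioms sub into add scale square by blast
qed

lemma short_exact_sequence:
  "short_exact_complexes
    (scale_fun sV) (\<lambda>n. C_DO sA sV (n - 1)) (\<lambda>n. hochschild_lam sA lam dA sV l r)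
    (module_prod.scale (scale_fun sV) (scale_fun sV)) (C_DA sA sV) (d_DA sA lam dA sV l r dV)
    (scale_fun sV) (C_Alg sA sV) (\<lambda>n. hochschild sV l r)
    (\<lambda>n g. (0, g)) (\<lambda>n (f, g). f)"
proof -
  interpret W: vector_space "scale_fun sV" by (rule V.vector_space_scale_fun)
  interpret P: vector_space_prod "scale_fun sV" "scale_fun sV" by unfold_locales
  have zero: "0 \<in> C_Alg sA sV n" for n
    by (rule W.subspace_0[OF subspace_C_Alg])
  have "cochain_map (scale_fun sV) (\<lambda>n. C_DO sA sV (n - 1)) (\<lambda>n. hochschild_lam sA lam dA sV l r)
      P.scale (C_DA sA sV) (d_DA sA lam dA sV l r dV) (\<lambda>n g. (0, g))"
    unfolding cochain_map_def linear_map_on_def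
    by (auto simp: C_DA_def zero P.scale_prod d_DA_eq hochschild_zero delta_zero)
  moreover have "cochain_map P.scale (C_DA sA sV) (d_DA sA lam dA sV l r dV)
      (scale_fun sV) (C_Alg sA sV) (\<lambda>n. hochschild sV l r) (\<lambda>n (f, g). f)"
    unfolding cochain_map_def linear_map_on_def
    by (auto simp: d_DA_eq P.scale_prod) (auto simp: C_DA_def)
  moreover have "(\<lambda>(f, g). f) ` C_DA sA sV n = C_Alg sA sV n" for n
    \<comment> \<open>The preimage of \<open>f\<close> is \<open>(f, 0)\<close>.\<close>
    using zero by (force simp: C_DA_def C_DO_def)
  ultimately show ?thesis
    unfolding short_exact_complexes_def
    using cochain_complex_C_DO cochain_complex_C_DA cochain_complex_C_Alg zero
    by (auto simp: C_DA_def C_DO_def zero_prod_def)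
qed

end

theorem proposition3p7:
  fixes sA :: "'k::field_char_0 \<Rightarrow> 'a::ring \<Rightarrow> 'a"
    and lam :: 'k
    and dA :: "'a \<Rightarrow> 'a"
    and sV :: "'k \<Rightarrow> 'v::ab_group_add \<Rightarrow> 'v"
    and l :: "'a \<Rightarrow> 'v \<Rightarrow> 'v"
    and r :: "'v \<Rightarrow> 'a \<Rightarrow> 'v"
    and dV :: "'v \<Rightarrow> 'v"
  assumes "differential_algebra sA lam dA"
    and "differential_bimodule sA lam dA sV l r dV"
  shows "short_exact_complexes
    (scale_fun sV) (\<lambda>n. C_DO sA sV (n - 1)) (\<lambda>n. hochschild_lam sA lam dA sV l r)
    (module_prod.scale (scale_fun sV) (scale_fun sV)) (C_DA sA sV) (d_DA sA lam dA sV l r dV)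
    (scale_fun sV) (C_Alg sA sV) (\<lambda>n. hochschild sV l r)
    (\<lambda>n g. (0, g)) (\<lambda>n (f, g). f)"
  using assms(2) by (rule differential_bimodule.short_exact_sequence)

end
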